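(* Let $\mathbb{X}$ and $\mathbb{Y}$ be Hausdorff topological spaces, let $\Phi:\mathbb{X}\to 2^{\mathbb{Y}}\setminus\{\emptyset\}$ be a lower semi-continuous set-valued mapping, and let $u:\mathbb{X}\times\mathbb{Y}\to\mathbb{R}$ be $\mathbb{K}\mathbb{N}$-inf-compact on $\mathrm{Gr}_{\mathbb{X}}(\Phi)$ and upper semi-continuous on $\mathrm{Gr}_{\mathbb{X}}(\Phi)$. Define $v(x):=\inf_{y\in\Phi(x)}u(x,y)$ and $\Phi^*(x):=\{y\in\Phi(x): v(x)=u(x,y)\}$ for $x\in\mathbb{X}$. Then $v$ takes values in $\mathbb{R}$ and $v:\mathbb{X}\to\mathbb{R}$ is continuous, and the set-valued mapping $\Phi^*$ has nonempty compact values and is upper semi-continuous.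
   Context: A set-valued mapping $F$ from $\mathbb{X}$ to the nonempty subsets of $\mathbb{Y}$ is upper semi-continuous at $x$ if for every neighborhood $\mathcal{G}$ of the set $F(x)$ there is a neighborhood $\mathcal{O}(x)$ of $x$ with $F(z)\subseteq\mathcal{G}$ for all $z\in\mathcal{O}(x)$. It is lower semi-continuous at $x$ if for every open $\mathcal{G}$ with $F(x)\cap\mathcal{G}\neq\emptyset$ there is a neighborhood $\mathcal{O}(x)$ of $x$ with $F(z)\cap\mathcal{G}\neq\emptyset$ for all $z\in\mathcal{O}(x)$. It is upper (lower) semi-continuous if it is so at every $x\in\mathbb{X}$. $\mathrm{Gr}_{\mathbb{X}}(\Phi)=\{(x,y)\in\mathbb{X}\times\mathbb{Y}: y\in\Phi(x)\}$. An extended-real-valued function $f$ on a nonempty subset $U$ of a topological space is lower semi-continuous on $U$ if all sets $\{y\in U: f(y)\le\lambda\}$, $\lambda\in\mathbb{R}$, are closed (in the subspace topology of $U$), and upper semi-continuous on $U$ if $-f$ is lower semi-continuous on $U$. A function $u:\mathbb{X}\times\mathbb{Y}\to\mathbb{R}\cup\{\pm\infty\}$ is $\mathbb{K}\mathbb{N}$-inf-compact on $\mathrm{Gr}_{\mathbb{X}}(\Phi)$ if: (i) $u$ is lower semi-continuous on $\mathrm{Gr}_{\mathbb{X}}(\Phi)$; and (ii) for any net $\{x_i\}_{i\in I}$ in $\mathbb{X}$ converging to some $x\in\mathbb{X}$, any net $\{y_i\}_{i\in I}$ (indexed by the same directed set $I$) with $y_i\in\Phi(x_i)$ for all $i\in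 I$ and such that the set $\{u(x_i,y_i): i\in I\}$ is bounded above by a real number has an accumulation point (i.e., a limit of some subnet) $y\in\Phi(x)$. *)

theory Defs
  imports "HOL-Analysis.Analysis"
begin

section \<open>Nets\<close>

definition directed_set :: "'i set \<Rightarrow> 'i rel \<Rightarrow> bool" where
  "directed_set I r \<longleftrightarrow>
     I \<noteq> {} \<and> preorder_on I r \<and> (\<forall>i\<in>I. \<forall>j\<in>I. \<exists>k\<in>I. (i, k) \<in> r \<and> (j, k) \<in> r)"

text \<open>
  The filter generated by the tails of a directed set (see \<open>eventually_net_filter\<close> below).
  A net \<open>x\<close> indexed by \<open>(I, r)\<close> converges to \<open>l\<close> iff \<open>(x \<longlongrightarrow> l) (net_filter I r)\<close>;
  the values of \<open>x\<close> outside \<open>I\<close> are irrelevant.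
\<close>
definition net_filter :: "'i set \<Rightarrow> 'i rel \<Rightarrow> 'i filter" where
  "net_filter I r = (INF i\<in>I. principal {j \<in> I. (i, j) \<in> r})"

text \<open>\<open>y \<circ> \<phi>\<close>, indexed by \<open>(J, s)\<close>, is a subnet of the net \<open>y\<close>, indexed by \<open>(I, r)\<close>.\<close>
definition subnet_map :: "'i set \<Rightarrow> 'i rel \<Rightarrow> 'j set \<Rightarrow> 'j rel \<Rightarrow> ('j \<Rightarrow> 'i) \<Rightarrow> bool" where
  "subnet_map I r J s \<phi> \<longleftrightarrow>
     directed_set J s \<and> \<phi> ` J \<subseteq> I \<and>
     (\<forall>i\<in>I. \<exists>j\<in>J. \<forall>j'\<in>J. (j, j') \<in> s \<longrightarrow> (i, \<phi> j') \<in> r)"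

text \<open>
  An accumulation point is a limit of some subnet. A definition cannot quantify over index types,
  so the subnet is indexed by a subset of \<open>'i \<times> 'b set\<close>; by
  \<open>net_accumulation_point_if_subnet_limit\<close> below, subnets indexed by other types do not give
  further accumulation points.
\<close>
definition net_accumulation_point ::
    "'i set \<Rightarrow> 'i rel \<Rightarrow> ('i \<Rightarrow> 'b::topological_space) \<Rightarrow> 'b \<Rightarrow> bool" where
  "net_accumulation_point I r y l \<longleftrightarrow>
     (\<exists>(J :: ('i \<times> 'b set) set) s \<phi>.
        subnet_map I r J s \<phi> \<and> ((\<lambda>j. y (\<phi> j)) \<longlongrightarrow> l) (net_filter J s))"


section \<open>Semi-continuity\<close>

text \<open>A neighbourhood of a set \<open>S\<close> is a set whose interior contains \<open>S\<close>.\<close>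
definition set_usc_at ::
    "('a::topological_space \<Rightarrow> 'b::topological_space set) \<Rightarrow> 'a \<Rightarrow> bool" where
  "set_usc_at F x \<longleftrightarrow> (\<forall>G. F x \<subseteq> interior G \<longrightarrow> (\<forall>\<^sub>F z in nhds x. F z \<subseteq> G))"

definition set_lsc_at ::
    "('a::topological_space \<Rightarrow> 'b::topological_space set) \<Rightarrow> 'a \<Rightarrow> bool" where
  "set_lsc_at F x \<longleftrightarrow>
     (\<forall>G. open G \<and> F x \<inter> G \<noteq> {} \<longrightarrow> (\<forall>\<^sub>F z in nhds x. F z \<inter> G \<noteq> {}))"

definition set_usc :: "('a::topological_space \<Rightarrow> 'b::topological_space set) \<Rightarrow> bool" where
  "set_usc F \<longleftrightarrow> (\<forall>x. set_usc_at F x)"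

definition set_lsc :: "('a::topological_space \<Rightarrow> 'b::topological_space set) \<Rightarrow> bool" where
  "set_lsc F \<longleftrightarrow> (\<forall>x. set_lsc_at F x)"

definition lsc_on :: "'c::topological_space set \<Rightarrow> ('c \<Rightarrow> ereal) \<Rightarrow> bool" where
  "lsc_on U f \<longleftrightarrow> (\<forall>c::real. closedin (top_of_set U) {y \<in> U. f y \<le> ereal c})"

definition usc_on :: "'c::topological_space set \<Rightarrow> ('c \<Rightarrow> ereal) \<Rightarrow> bool" where
  "usc_on U f \<longleftrightarrow> lsc_on U (\<lambda>y. - f y)"


section \<open>KN-inf-compactness\<close>

definition Gr :: "('a \<Rightarrow> 'b set) \<Rightarrow> ('a \<times> 'b) set" where
  "Gr \<Phi> = {(x, y). y \<in> \<Phi> x}"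

text \<open>Condition (ii) of KN-inf-compactness for nets indexed by subsets of the type \<open>'i\<close>.\<close>
definition KN_net_condition ::
    "'i itself \<Rightarrow> ('a::topological_space \<Rightarrow> 'b::topological_space set) \<Rightarrow>
     ('a \<times> 'b \<Rightarrow> ereal) \<Rightarrow> bool" where
  "KN_net_condition TYPE('i) \<Phi> u \<longleftrightarrow>
     (\<forall>(I :: 'i set) r (xs :: 'i \<Rightarrow> 'a) (ys :: 'i \<Rightarrow> 'b) x.
        directed_set I r \<and> (xs \<longlongrightarrow> x) (net_filter I r) \<and>
        (\<forall>i\<in>I. ys i \<in> \<Phi> (xs i)) \<and>
        (\<exists>c::real. \<forall>i\<in>I. u (xs i, ys i) \<le> ereal c)
        \<longrightarrow> (\<exists>y\<in>\<Phi> x. net_accumulation_point I r ys y))"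

text \<open>
  The chosen index type is large enough: by \<open>KN_net_condition_any_index_type\<close> below, the condition
  then holds for nets indexed by any type.
\<close>
definition KN_inf_compact ::
    "('a::topological_space \<Rightarrow> 'b::topological_space set) \<Rightarrow> ('a \<times> 'b \<Rightarrow> ereal) \<Rightarrow> bool" where
  "KN_inf_compact \<Phi> u \<longleftrightarrow>
     lsc_on (Gr \<Phi>) u \<and> KN_net_condition TYPE(('a \<times> 'b) \<times> ('a \<times> 'b) set) \<Phi> u"


section \<open>Value function and solution mapping\<close>

text \<open>The infimum is taken in the extended reals.\<close>
definition value_function :: "('a \<Rightarrow> 'b set) \<Rightarrow> ('a \<times> 'b \<Rightarrow> real) \<Rightarrow> 'a \<Rightarrow> ereal" where
  "value_function \<Phi> u x = (INF y\<in>\<Phi> x. ereal (u (x, y)))"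

definition solution_set :: "('a \<Rightarrow> 'b set) \<Rightarrow> ('a \<times> 'b \<Rightarrow> real) \<Rightarrow> 'a \<Rightarrow> 'b set" where
  "solution_set \<Phi> u x = {y \<in> \<Phi> x. value_function \<Phi> u x = ereal (u (x, y))}"


section \<open>Independence of the index types\<close>

lemma eventually_net_filter:
  assumes "directed_set I r"
  shows "eventually P (net_filter I r) \<longleftrightarrow> (\<exists>i\<in>I. \<forall>j\<in>I. (i, j) \<in> r \<longrightarrow> P j)"
proof -
  have tr: "trans r" using assms by (simp add: directed_set_def preorder_on_def)
  have "\<exists>k\<in>I. principal {j\<in>I. (k, j) \<in> r} \<le>
          inf (principal {j\<in>I. (a, j) \<in> r}) (principal {j\<in>I. (b, j) \<in> r})"
    if ab: "a \<in> I" "b \<in> I" for a b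
  proof -
    obtain k where "k \<in> I" "(a, k) \<in> r" "(b, k) \<in> r"
      using assms ab by (auto simp: directed_set_def)
    then show ?thesis using tr by (auto intro!: bexI[of _ k] dest: transD)
  qed
  moreover have "I \<noteq> {}" using assms by (simp add: directed_set_def)
  ultimately show ?thesis
    unfolding net_filter_def by (subst eventually_INF_base) (auto simp: eventually_principal)
qed

lemma tendsto_net_filter:
  assumes "directed_set I r"
  shows "(x \<longlongrightarrow> l) (net_filter I r) \<longleftrightarrow>
    (\<forall>U. open U \<and> l \<in> U \<longrightarrow> (\<exists>i\<in>I. \<forall>j\<in>I. (i, j) \<in> r \<longrightarrow> x j \<in> U))"
  unfolding tendsto_def eventually_net_filter[OF assms] by auto

lemma subnet_limit_frequently:
  assumes s: "subnet_map I r J s \<phi>" and lim: "((\<lambda>j. y (\<phi> j)) \<longlongrightarrow> l) (net_filter J s)"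
  shows "\<forall>U. open U \<and> l \<in> U \<longrightarrow> (\<forall>i\<in>I. \<exists>j\<in>I. (i, j) \<in> r \<and> y j \<in> U)"
proof (intro allI impI ballI)
  have dJ: "directed_set J s" using s by (simp add: subnet_map_def)
  fix U i assume U: "open U \<and> l \<in> U" and i: "i \<in> I"
  obtain a where a: "a \<in> J" "\<And>j. j \<in> J \<Longrightarrow> (a, j) \<in> s \<Longrightarrow> y (\<phi> j) \<in> U"
    using lim U unfolding tendsto_net_filter[OF dJ] by blast
  obtain b where b: "b \<in> J" "\<And>j. j \<in> J \<Longrightarrow> (b, j) \<in> s \<Longrightarrow> (i, \<phi> j) \<in> r"
    using s i unfolding subnet_map_def by blast
  obtain k where "k \<in> J" "(a, k) \<in> s" "(b, k) \<in> s"
    using dJ a(1) b(1) unfolding directed_set_def by blast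
  then show "\<exists>j\<in>I. (i, j) \<in> r \<and> y j \<in> U"
    using a b s unfolding subnet_map_def by blast
qed

lemma net_accumulation_point_iff:
  fixes y :: "'i \<Rightarrow> 'b::topological_space"
  assumes dir: "directed_set I r"
  shows "net_accumulation_point I r y l \<longleftrightarrow>
    (\<forall>U. open U \<and> l \<in> U \<longrightarrow> (\<forall>i\<in>I. \<exists>j\<in>I. (i, j) \<in> r \<and> y j \<in> U))" (is "?L \<longleftrightarrow> ?R")
proof
  assume ?L
  then show ?R
    unfolding net_accumulation_point_def by (blast dest: subnet_limit_frequently)
next
  assume R: ?R
  define J where "J = {(i, U). i \<in> I \<and> open U \<and> l \<in> U \<and> y i \<in> U}"
  define s where "s = {((i, U), (i', U')). (i, U) \<in> J \<and> (i', U') \<in> J \<and> (i, i') \<in> r \<and> U' \<subseteq> U}"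
  have rfl: "\<And>i. i \<in> I \<Longrightarrow> (i, i) \<in> r" and tr: "\<And>i j k. (i, j) \<in> r \<Longrightarrow> (j, k) \<in> r \<Longrightarrow> (i, k) \<in> r"
    and ne: "I \<noteq> {}"
    using dir unfolding directed_set_def preorder_on_def by (auto dest: refl_onD transD)
  have dJ: "directed_set J s"
    unfolding directed_set_def preorder_on_def
  proof (intro conjI ballI)
    show "J \<noteq> {}" using ne by (auto simp: J_def)
    show "s \<subseteq> J \<times> J" by (auto simp: s_def)
    show "refl_on J s" using rfl by (auto simp: refl_on_def s_def J_def)
    show "trans s" by (rule transI) (auto simp: s_def dest: tr)
    fix p q assume "p \<in> J" "q \<in> J"
    then obtain i U j V where pq: "p = (i, U)" "q = (j, V)" "(i, U) \<in> J" "(j, V) \<in> J"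
      by (cases p, cases q) auto
    then obtain k where k: "k \<in> I" "(i, k) \<in> r" "(j, k) \<in> r"
      using dir unfolding J_def directed_set_def by blast
    have "open (U \<inter> V) \<and> l \<in> U \<inter> V" using pq by (auto simp: J_def)
    then obtain m where m: "m \<in> I" "(k, m) \<in> r" "y m \<in> U \<inter> V" using R k(1) by blast
    have "(m, U \<inter> V) \<in> J" using m pq by (auto simp: J_def)
    moreover have "(i, m) \<in> r" "(j, m) \<in> r" using k m tr by blast+
    ultimately show "\<exists>k\<in>J. (p, k) \<in> s \<and> (q, k) \<in> s"
      using pq by (intro bexI[of _ "(m, U \<inter> V)"]) (auto simp: s_def)
  qed
  have "subnet_map I r J s fst"
    unfolding subnet_map_def
  proof (intro conjI dJ ballI)
    show "fst ` J \<subseteq> I" by (auto simp: J_def)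
    fix i assume "i \<in> I"
    then have "(i, UNIV) \<in> J" by (auto simp: J_def)
    then show "\<exists>j\<in>J. \<forall>j'\<in>J. (j, j') \<in> s \<longrightarrow> (i, fst j') \<in> r"
      by (rule bexI[rotated]) (auto simp: s_def)
  qed
  moreover have "((\<lambda>j. y (fst j)) \<longlongrightarrow> l) (net_filter J s)"
    unfolding tendsto_net_filter[OF dJ]
  proof (intro allI impI)
    fix U assume U: "open U \<and> l \<in> U"
    then obtain i where "i \<in> I" "y i \<in> U" using R ne by blast
    then have "(i, U) \<in> J" using U by (auto simp: J_def)
    then show "\<exists>j\<in>J. \<forall>j'\<in>J. (j, j') \<in> s \<longrightarrow> y (fst j') \<in> U"
      by (rule bexI[rotated]) (auto simp: s_def J_def)
  qed
  ultimately show ?L unfolding net_accumulation_point_def by blast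
qed

lemma net_accumulation_point_if_subnet_limit:
  fixes J :: "'j set" and y :: "'i \<Rightarrow> 'b::topological_space"
  assumes dir: "directed_set I r" and s: "subnet_map I r J s \<phi>"
    and lim: "((\<lambda>j. y (\<phi> j)) \<longlongrightarrow> l) (net_filter J s)"
  shows "net_accumulation_point I r y l"
  using subnet_limit_frequently[OF s lim] net_accumulation_point_iff[OF dir] by blast

lemma KN_net_condition_any_index_type:
  fixes \<Phi> :: "'a::topological_space \<Rightarrow> 'b::topological_space set"
  assumes "KN_net_condition TYPE(('a \<times> 'b) \<times> ('a \<times> 'b) set) \<Phi> u"
  shows "KN_net_condition TYPE('i) \<Phi> u"
  unfolding KN_net_condition_def
proof (intro allI impI, elim conjE exE)
  fix I :: "'i set" and r xs ys x and c :: real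
  assume dir: "directed_set I r" and lim: "(xs \<longlongrightarrow> x) (net_filter I r)"
    and feas: "\<forall>i\<in>I. ys i \<in> \<Phi> (xs i)" and bdd: "\<forall>i\<in>I. u (xs i, ys i) \<le> ereal c"
  have rfl: "\<And>i. i \<in> I \<Longrightarrow> (i, i) \<in> r" and tr: "\<And>i j k. (i, j) \<in> r \<Longrightarrow> (j, k) \<in> r \<Longrightarrow> (i, k) \<in> r"
    and ne: "I \<noteq> {}"
    using dir unfolding directed_set_def preorder_on_def by (auto dest: refl_onD transD)
  define T where "T i = {(xs j, ys j) | j. j \<in> I \<and> (i, j) \<in> r}" for i
  define J where "J = {(p, A). p \<in> A \<and> A \<in> T ` I}"
  define s where "s = {(a, b). a \<in> J \<and> b \<in> J \<and> snd b \<subseteq> snd a}"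
  have T_self: "(xs i, ys i) \<in> T i" if "i \<in> I" for i using that rfl by (auto simp: T_def)
  have T_mono: "T j \<subseteq> T i" if "(i, j) \<in> r" for i j using that tr by (auto simp: T_def)
  have T_J: "((xs i, ys i), T i) \<in> J" if "i \<in> I" for i using T_self that by (auto simp: J_def)
  have J_cases: "\<exists>i\<in>I. fst p = (xs i, ys i)" if "p \<in> J" for p
    using that by (auto simp: J_def T_def)
  have dJ: "directed_set J s"
    unfolding directed_set_def preorder_on_def
  proof (intro conjI ballI)
    show "J \<noteq> {}" using ne T_J by blast
    show "s \<subseteq> J \<times> J" "refl_on J s" "trans s" by (auto simp: s_def refl_on_def trans_def)
    fix p q assume p: "p \<in> J" and q: "q \<in> J"
    obtain i where i: "i \<in> I" "snd p = T i" using p by (auto simp: J_def)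
    obtain j where j: "j \<in> I" "snd q = T j" using q by (auto simp: J_def)
    obtain k where k: "k \<in> I" "(i, k) \<in> r" "(j, k) \<in> r"
      using dir i j unfolding directed_set_def by blast
    then have "T k \<subseteq> snd p" "T k \<subseteq> snd q" using T_mono i(2) j(2) by auto
    then show "\<exists>k\<in>J. (p, k) \<in> s \<and> (q, k) \<in> s"
      using p q T_J[OF k(1)] by (intro bexI[OF _ T_J[OF k(1)]]) (auto simp: s_def)
  qed
  have "((\<lambda>p. fst (fst p)) \<longlongrightarrow> x) (net_filter J s)"
    unfolding tendsto_net_filter[OF dJ]
  proof (intro allI impI)
    fix U assume "open U \<and> x \<in> U"
    then obtain i where i: "i \<in> I" "\<And>j. j \<in> I \<Longrightarrow> (i, j) \<in> r \<Longrightarrow> xs j \<in> U"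
      using lim unfolding tendsto_net_filter[OF dir] by blast
    then have "fst ` T i \<subseteq> U" by (auto simp: T_def)
    moreover have "fst q \<in> T i" if "(((xs i, ys i), T i), q) \<in> s" for q
      using that by (auto simp: s_def J_def)
    ultimately show "\<exists>j\<in>J. \<forall>j'\<in>J. (j, j') \<in> s \<longrightarrow> fst (fst j') \<in> U"
      using T_J[OF i(1)] by blast
  qed
  moreover have "\<forall>p\<in>J. snd (fst p) \<in> \<Phi> (fst (fst p))"
    using J_cases feas by fastforce
  moreover have "\<exists>c::real. \<forall>p\<in>J. u (fst (fst p), snd (fst p)) \<le> ereal c"
    using J_cases bdd by (intro exI[of _ c]) fastforce
  ultimately obtain y where y: "y \<in> \<Phi> x" "net_accumulation_point J s (\<lambda>p. snd (fst p)) y"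
    using assms[unfolded KN_net_condition_def, rule_format,
        of J s "\<lambda>p. fst (fst p)" x "\<lambda>p. snd (fst p)"] dJ by blast
  have "net_accumulation_point I r ys y"
    unfolding net_accumulation_point_iff[OF dir]
  proof (intro allI impI ballI)
    fix U i assume "open U \<and> y \<in> U" and i: "i \<in> I"
    then obtain q where "(((xs i, ys i), T i), q) \<in> s" "snd (fst q) \<in> U"
      using y(2) T_J[OF i] unfolding net_accumulation_point_iff[OF dJ] by blast
    then have "fst q \<in> T i" "snd (fst q) \<in> U" by (auto simp: s_def J_def)
    then show "\<exists>j\<in>I. (i, j) \<in> r \<and> ys j \<in> U" by (auto simp: T_def)
  qed
  with y(1) show "\<exists>y\<in>\<Phi> x. net_accumulation_point I r ys y" by blast
qed

end

theory Submission
  imports Defs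
begin

text \<open>
  Write \<open>v\<close> for the value function and \<open>\<Phi>\<^sup>*\<close> for the solution mapping. Everything rests on one
  compactness principle, \<open>KN_cluster_point\<close>. It considers points \<open>(xs i, ys i)\<close> of the graph with
  \<open>u\<close> bounded above along them, where \<open>xs\<close> tends to \<open>x\<close> along a proper filter. Then \<open>ys\<close> has a
  cluster point \<open>y \<in> \<Phi> x\<close>, and every eventual upper bound of \<open>u\<close> along the filter is still an upper
  bound of \<open>u (x, y)\<close>. Existence of \<open>y\<close> is condition (ii) of KN-inf-compactness, and the bound is
  lower semi-continuity of \<open>u\<close> on the graph. Four choices of the filter give the theorem:
  \<^item> a minimising sequence at \<open>x\<close> clusters at a minimiser, so that \<open>\<Phi>\<^sup>* x\<close> is nonempty and \<open>v x\<close> is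
    finite;
  \<^item> every filter on \<open>\<Phi>\<^sup>* x\<close> clusters at a minimiser, so that \<open>\<Phi>\<^sup>* x\<close> is compact;
  \<^item> minimisers at points \<open>z \<rightarrow> x\<close> with \<open>v z \<le> c\<close> cluster at a \<open>y \<in> \<Phi> x\<close> with \<open>u (x, y) \<le> c\<close>, so that
    \<open>v\<close> is lower semi-continuous;
  \<^item> minimisers at points \<open>z \<rightarrow> x\<close> that lie outside \<open>G\<close> would cluster at a minimiser outside the
    interior of \<open>G\<close>, so that \<open>\<Phi>\<^sup>*\<close> is upper semi-continuous.

  The last item needs \<open>limsup v z \<le> v x\<close>. This is the only place where lower semi-continuity of \<open>\<Phi>\<close>
  and upper semi-continuity of \<open>u\<close> enter (\<open>value_function_less_eventually\<close>): a point \<open>y \<in> \<Phi> x\<close> with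
  \<open>u (x, y) < c\<close> has, in \<open>\<Phi> z\<close> for \<open>z\<close> near \<open>x\<close>, neighbours at which \<open>u\<close> is still below \<open>c\<close>.
\<close>

section \<open>Cluster points along filters\<close>

text \<open>
  Condition (ii) for filters instead of nets. The net attached to a filter \<open>F\<close> runs through the
  pairs of a large set and a point of it; a tail of this net consists of all points of a large set.
\<close>
lemma KN_net_condition_filter:
  fixes \<Phi> :: "'a::topological_space \<Rightarrow> 'b::topological_space set"
  assumes KN: "KN_net_condition TYPE(('a \<times> 'b) \<times> ('a \<times> 'b) set) \<Phi> u"
    and F: "F \<noteq> bot" and lim: "(fst \<longlongrightarrow> x) F"
    and feas: "\<forall>\<^sub>F p in F. p \<in> Gr \<Phi>" and bdd: "\<forall>\<^sub>F p in F. u p \<le> ereal c"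
  shows "\<exists>y\<in>\<Phi> x. \<forall>U. open U \<and> y \<in> U \<longrightarrow> (\<exists>\<^sub>F p in F. snd p \<in> U)"
proof -
  define S where "S = {p \<in> Gr \<Phi>. u p \<le> ereal c}"
  define I where "I = {(p, A). p \<in> A \<and> A \<subseteq> S \<and> eventually (\<lambda>q. q \<in> A) F}"
  define r where "r = {(a, b). a \<in> I \<and> b \<in> I \<and> snd b \<subseteq> snd a}"
  have S: "eventually (\<lambda>q. q \<in> S) F"
    unfolding S_def using feas bdd by eventually_elim auto
  have ex: "\<exists>p. (p, A \<inter> S) \<in> I" if "eventually (\<lambda>q. q \<in> A) F" for A
  proof -
    have "eventually (\<lambda>q. q \<in> A \<inter> S) F" using that S by eventually_elim auto
    then show ?thesis using eventually_happens'[OF F] unfolding I_def by fastforce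
  qed
  have dir: "directed_set I r"
    unfolding directed_set_def preorder_on_def
  proof (intro conjI ballI)
    show "I \<noteq> {}" using ex[OF S] by blast
    show "r \<subseteq> I \<times> I" "refl_on I r" "trans r" by (auto simp: r_def refl_on_def trans_def)
    fix a b assume a: "a \<in> I" and b: "b \<in> I"
    have "eventually (\<lambda>q. q \<in> snd a) F" "eventually (\<lambda>q. q \<in> snd b) F"
      using a b by (auto simp: I_def)
    then have "eventually (\<lambda>q. q \<in> snd a \<inter> snd b) F" by eventually_elim auto
    then obtain p where "(p, snd a \<inter> snd b \<inter> S) \<in> I" using ex by blast
    then show "\<exists>k\<in>I. (a, k) \<in> r \<and> (b, k) \<in> r"
      using a b by (intro bexI) (auto simp: r_def)
  qed
  have "((\<lambda>i. fst (fst i)) \<longlongrightarrow> x) (net_filter I r)"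
    unfolding tendsto_net_filter[OF dir]
  proof (intro allI impI)
    fix U assume "open U \<and> x \<in> U"
    then have "eventually (\<lambda>q. q \<in> fst -` U) F" using lim by (auto simp: tendsto_def)
    then obtain p where "(p, fst -` U \<inter> S) \<in> I" using ex by blast
    then show "\<exists>i\<in>I. \<forall>j\<in>I. (i, j) \<in> r \<longrightarrow> fst (fst j) \<in> U"
      by (rule bexI[rotated]) (auto simp: r_def I_def)
  qed
  moreover have "\<forall>i\<in>I. snd (fst i) \<in> \<Phi> (fst (fst i))"
    and "\<forall>i\<in>I. u (fst (fst i), snd (fst i)) \<le> ereal c"
    by (auto simp: I_def S_def Gr_def)
  ultimately obtain y where y: "y \<in> \<Phi> x" "net_accumulation_point I r (\<lambda>i. snd (fst i)) y"
    using KN[unfolded KN_net_condition_def, rule_format,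
        of I r "\<lambda>i. fst (fst i)" x "\<lambda>i. snd (fst i)"] dir by blast
  have "\<exists>\<^sub>F p in F. snd p \<in> U" if U: "open U" "y \<in> U" for U
    unfolding frequently_def
  proof
    assume "\<forall>\<^sub>F p in F. snd p \<notin> U"
    then have "eventually (\<lambda>q. q \<in> {p. snd p \<notin> U}) F" by simp
    then obtain p where "(p, {p. snd p \<notin> U} \<inter> S) \<in> I" using ex by blast
    then obtain j where "((p, {p. snd p \<notin> U} \<inter> S), j) \<in> r" "snd (fst j) \<in> U"
      using y(2) U unfolding net_accumulation_point_iff[OF dir] by blast
    then show False by (auto simp: r_def I_def)
  qed
  with y(1) show ?thesis by blast
qed

text \<open>
  Since \<open>xs\<close> converges to \<open>x\<close>, each product neighbourhood of \<open>(x, y)\<close> is visited frequently by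
  \<open>(xs i, ys i)\<close>. The set \<open>{u \<le> d}\<close> is relatively closed in the graph, so it contains \<open>(x, y)\<close> once
  it contains the points \<open>(xs i, ys i)\<close> eventually. All bounds \<open>d\<close> are served by the same \<open>y\<close>, which
  is what \<open>solution_cluster_point\<close> needs.
\<close>
lemma KN_cluster_point:
  fixes \<Phi> :: "'a::topological_space \<Rightarrow> 'b::topological_space set" and u :: "'a \<times> 'b \<Rightarrow> ereal"
  assumes KN: "KN_inf_compact \<Phi> u"
    and F: "F \<noteq> bot" and lim: "(xs \<longlongrightarrow> x) F"
    and feas: "\<forall>\<^sub>F i in F. ys i \<in> \<Phi> (xs i)"
    and bdd: "\<forall>\<^sub>F i in F. u (xs i, ys i) \<le> ereal c"
  obtains y where "y \<in> \<Phi> x" "\<forall>U. open U \<and> y \<in> U \<longrightarrow> (\<exists>\<^sub>F i in F. ys i \<in> U)"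
    "\<forall>d. (\<forall>\<^sub>F i in F. u (xs i, ys i) \<le> ereal d) \<longrightarrow> u (x, y) \<le> ereal d"
proof -
  let ?P = "filtermap (\<lambda>i. (xs i, ys i)) F"
  have "\<exists>y\<in>\<Phi> x. \<forall>U. open U \<and> y \<in> U \<longrightarrow> (\<exists>\<^sub>F p in ?P. snd p \<in> U)"
  proof (rule KN_net_condition_filter)
    show "KN_net_condition TYPE(('a \<times> 'b) \<times> ('a \<times> 'b) set) \<Phi> u"
      using KN by (simp add: KN_inf_compact_def)
    show "(fst \<longlongrightarrow> x) ?P" using lim by (simp add: tendsto_def eventually_filtermap)
  qed (use F feas bdd in \<open>auto simp: filtermap_bot_iff eventually_filtermap Gr_def\<close>)
  then obtain y where y: "y \<in> \<Phi> x"
    and cluster: "\<forall>U. open U \<and> y \<in> U \<longrightarrow> (\<exists>\<^sub>F i in F. ys i \<in> U)"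
    by (auto simp: frequently_def eventually_filtermap)
  have "u (x, y) \<le> ereal d" if d: "\<forall>\<^sub>F i in F. u (xs i, ys i) \<le> ereal d" for d
  proof (rule ccontr)
    assume gt: "\<not> u (x, y) \<le> ereal d"
    have "closedin (top_of_set (Gr \<Phi>)) {p \<in> Gr \<Phi>. u p \<le> ereal d}"
      using KN by (simp add: KN_inf_compact_def lsc_on_def)
    then obtain T where T: "closed T" "{p \<in> Gr \<Phi>. u p \<le> ereal d} = T \<inter> Gr \<Phi>"
      by (auto simp: closedin_closed)
    then have "(x, y) \<in> - T" "open (- T)" using gt y by (auto simp: Gr_def)
    then obtain A B where AB: "open A" "open B" "x \<in> A" "y \<in> B" "A \<times> B \<subseteq> - T"
      by (auto elim!: open_prod_elim)
    have "\<forall>\<^sub>F i in F. xs i \<in> A" using lim AB by (auto simp: tendsto_def)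
    with d feas have "\<forall>\<^sub>F i in F. ys i \<notin> B"
      by eventually_elim (use T(2) AB(5) in \<open>auto simp: Gr_def\<close>)
    then show False using cluster AB(2,4) by (simp add: frequently_def)
  qed
  then show thesis using that y cluster by simp
qed

lemma value_function_le: "y \<in> \<Phi> x \<Longrightarrow> value_function \<Phi> u x \<le> ereal (u (x, y))"
  by (auto simp: value_function_def intro: INF_lower)

text \<open>
  Asymptotically optimal points cluster at a solution: the cluster point of \<open>KN_cluster_point\<close>
  inherits each bound \<open>d > v x\<close>, hence also \<open>v x\<close>.
\<close>
lemma solution_cluster_point:
  fixes \<Phi> :: "'a::topological_space \<Rightarrow> 'b::topological_space set" and u :: "'a \<times> 'b \<Rightarrow> real"
  assumes ne: "\<Phi> x \<noteq> {}" and KN: "KN_inf_compact \<Phi> (\<lambda>p. ereal (u p))"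
    and F: "F \<noteq> bot" and lim: "(xs \<longlongrightarrow> x) F"
    and feas: "\<forall>\<^sub>F i in F. ys i \<in> \<Phi> (xs i)"
    and bdd: "\<And>d. value_function \<Phi> u x < ereal d \<Longrightarrow> \<forall>\<^sub>F i in F. u (xs i, ys i) < d"
  obtains y where "y \<in> solution_set \<Phi> u x" "\<forall>U. open U \<and> y \<in> U \<longrightarrow> (\<exists>\<^sub>F i in F. ys i \<in> U)"
proof -
  obtain y0 where y0: "y0 \<in> \<Phi> x" using ne by blast
  have le: "\<forall>\<^sub>F i in F. ereal (u (xs i, ys i)) \<le> ereal d"
    if "value_function \<Phi> u x < ereal d" for d
    using bdd[OF that] by eventually_elim simp
  have "value_function \<Phi> u x < ereal (u (x, y0) + 1)"
    using value_function_le[of y0 \<Phi> x u] y0 by (auto intro: le_less_trans)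
  then obtain y where y: "y \<in> \<Phi> x" "\<forall>U. open U \<and> y \<in> U \<longrightarrow> (\<exists>\<^sub>F i in F. ys i \<in> U)"
    and d: "\<forall>d. (\<forall>\<^sub>F i in F. ereal (u (xs i, ys i)) \<le> ereal d) \<longrightarrow> ereal (u (x, y)) \<le> ereal d"
    by (rule KN_cluster_point[OF KN F lim feas le])
  have "ereal (u (x, y)) \<le> value_function \<Phi> u x"
  proof (rule ccontr)
    assume "\<not> ?thesis"
    then have "value_function \<Phi> u x < ereal (u (x, y))" by simp
    from ereal_dense2[OF this] obtain e
      where e: "value_function \<Phi> u x < ereal e" "ereal e < ereal (u (x, y))" by blast
    show False using d le[OF e(1)] e(2) by auto
  qed
  then have "y \<in> solution_set \<Phi> u x"
    using y(1) value_function_le[of y \<Phi> x u] by (auto simp: solution_set_def)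
  then show thesis using y(2) by (rule that)
qed

section \<open>The solution set at a point\<close>

lemma solution_set_nonempty:
  fixes \<Phi> :: "'a::topological_space \<Rightarrow> 'b::topological_space set" and u :: "'a \<times> 'b \<Rightarrow> real"
  assumes ne: "\<Phi> x \<noteq> {}" and KN: "KN_inf_compact \<Phi> (\<lambda>p. ereal (u p))"
  shows "solution_set \<Phi> u x \<noteq> {}"
proof -
  have "(\<lambda>y. ereal (u (x, y))) ` \<Phi> x \<noteq> {}" using ne by simp
  from Inf_as_limit[OF this] obtain w where w: "\<And>n. w n \<in> (\<lambda>y. ereal (u (x, y))) ` \<Phi> x"
    "w \<longlonglongrightarrow> value_function \<Phi> u x" unfolding value_function_def by blast
  then obtain ys where ys: "\<And>n::nat. ys n \<in> \<Phi> x" "\<And>n. w n = ereal (u (x, ys n))"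
    unfolding image_iff by metis
  \<comment> \<open>\<open>v x = -\<infinity>\<close> is not yet excluded, so \<open>u (x, ys n)\<close> is compared with real bounds above \<open>v x\<close>.\<close>
  have bdd: "\<forall>\<^sub>F n in sequentially. u (x, ys n) < d" if "value_function \<Phi> u x < ereal d" for d
    using order_tendstoD(2)[OF w(2) that] by (simp add: ys)
  have feas: "\<forall>\<^sub>F n in sequentially. ys n \<in> \<Phi> x" using ys(1) by simp
  obtain y where "y \<in> solution_set \<Phi> u x"
    by (rule solution_cluster_point[OF ne KN sequentially_bot tendsto_const feas bdd])
  then show ?thesis by blast
qed

lemma compact_solution_set:
  fixes \<Phi> :: "'a::topological_space \<Rightarrow> 'b::topological_space set" and u :: "'a \<times> 'b \<Rightarrow> real"
  assumes ne: "\<Phi> x \<noteq> {}" and KN: "KN_inf_compact \<Phi> (\<lambda>p. ereal (u p))"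
  shows "compact (solution_set \<Phi> u x)"
  unfolding compact_filter
proof (intro allI impI)
  fix F :: "'b filter"
  assume F: "F \<noteq> bot" and sol: "\<forall>\<^sub>F y in F. y \<in> solution_set \<Phi> u x"
  have feas: "\<forall>\<^sub>F y in F. y \<in> \<Phi> x" using sol by eventually_elim (simp add: solution_set_def)
  have bdd: "\<forall>\<^sub>F y in F. u (x, y) < d" if "value_function \<Phi> u x < ereal d" for d
    using sol by eventually_elim (use that in \<open>auto simp: solution_set_def\<close>)
  obtain y where y: "y \<in> solution_set \<Phi> u x" "\<forall>U. open U \<and> y \<in> U \<longrightarrow> (\<exists>\<^sub>F i in F. i \<in> U)"
    by (rule solution_cluster_point[OF ne KN F tendsto_const feas bdd])
  have "inf (nhds y) F \<noteq> bot"
  proof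
    assume "inf (nhds y) F = bot"
    then obtain P Q where "eventually P (nhds y)" "eventually Q F" and PQ: "\<And>z. P z \<Longrightarrow> \<not> Q z"
      unfolding trivial_limit_def eventually_inf by auto
    then obtain U where U: "open U" "y \<in> U" "\<And>z. z \<in> U \<Longrightarrow> P z" by (auto simp: eventually_nhds)
    have "\<forall>\<^sub>F z in F. z \<notin> U" using \<open>eventually Q F\<close> by eventually_elim (use U PQ in blast)
    then show False using y(2) U(1,2) by (simp add: frequently_def)
  qed
  then show "\<exists>y\<in>solution_set \<Phi> u x. inf (nhds y) F \<noteq> bot" using y(1) by blast
qed

section \<open>Dependence on the parameter\<close>

lemma value_function_less_eventually:
  fixes \<Phi> :: "'a::topological_space \<Rightarrow> 'b::topological_space set" and u :: "'a \<times> 'b \<Rightarrow> real"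
  assumes lsc: "set_lsc_at \<Phi> x" and usc: "usc_on (Gr \<Phi>) (\<lambda>p. ereal (u p))"
    and less: "value_function \<Phi> u x < ereal c"
  shows "\<forall>\<^sub>F z in nhds x. value_function \<Phi> u z < ereal c"
proof -
  obtain y where y: "y \<in> \<Phi> x" "u (x, y) < c"
    using less by (auto simp: value_function_def INF_less_iff)
  have "closedin (top_of_set (Gr \<Phi>)) {p \<in> Gr \<Phi>. - ereal (u p) \<le> ereal (- c)}"
    using usc by (simp add: usc_on_def lsc_on_def del: uminus_ereal.simps)
  then obtain T where T: "closed T" "{p \<in> Gr \<Phi>. - u p \<le> - c} = T \<inter> Gr \<Phi>"
    by (auto simp: closedin_closed)
  have "(x, y) \<notin> T \<inter> Gr \<Phi>" unfolding T(2)[symmetric] using y by auto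
  then have "(x, y) \<in> - T" "open (- T)" using T(1) y by (auto simp: Gr_def)
  then obtain A B where AB: "open A" "open B" "x \<in> A" "y \<in> B" "A \<times> B \<subseteq> - T"
    by (auto elim!: open_prod_elim)
  have "\<forall>\<^sub>F z in nhds x. \<Phi> z \<inter> B \<noteq> {}"
    using lsc AB y(1) unfolding set_lsc_at_def by blast
  moreover have "\<forall>\<^sub>F z in nhds x. z \<in> A" using AB by (auto simp: eventually_nhds)
  ultimately show ?thesis
  proof eventually_elim
    case (elim z)
    then obtain y' where y': "y' \<in> \<Phi> z" "y' \<in> B" by blast
    then have "(z, y') \<notin> T \<inter> Gr \<Phi>" using AB(5) elim by auto
    then have "u (z, y') < c" unfolding T(2)[symmetric] using y' by (auto simp: Gr_def)
    then show ?case using value_function_le[of y' \<Phi> z u] y' by (auto intro: le_less_trans)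
  qed
qed

lemma value_function_greater_eventually:
  fixes \<Phi> :: "'a::topological_space \<Rightarrow> 'b::topological_space set" and u :: "'a \<times> 'b \<Rightarrow> real"
  assumes ne: "\<And>x. \<Phi> x \<noteq> {}" and KN: "KN_inf_compact \<Phi> (\<lambda>p. ereal (u p))"
    and less: "ereal c < value_function \<Phi> u x"
  shows "\<forall>\<^sub>F z in nhds x. ereal c < value_function \<Phi> u z"
proof (rule ccontr)
  assume not: "\<not> ?thesis"
  \<comment> \<open>If the claim fails, every neighbourhood of \<open>x\<close> meets \<open>{v \<le> c}\<close>, so this filter is proper.\<close>
  define F where "F = inf (nhds x) (principal {z. value_function \<Phi> u z \<le> ereal c})"
  have F: "F \<noteq> bot"
    using not by (auto simp: F_def trivial_limit_def eventually_inf_principal not_le)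
  have lim: "((\<lambda>z. z) \<longlongrightarrow> x) F" unfolding F_def filterlim_def by simp
  have "\<forall>z. \<exists>y. y \<in> solution_set \<Phi> u z" using solution_set_nonempty[OF ne KN] by blast
  then obtain ys where ys: "\<And>z. ys z \<in> solution_set \<Phi> u z" by metis
  have feas: "\<forall>\<^sub>F z in F. ys z \<in> \<Phi> z" using ys by (simp add: solution_set_def)
  have bdd: "\<forall>\<^sub>F z in F. ereal (u (z, ys z)) \<le> ereal c"
    using ys by (auto simp: F_def eventually_inf_principal solution_set_def)
  obtain y where y: "y \<in> \<Phi> x"
    and d: "\<forall>d. (\<forall>\<^sub>F z in F. ereal (u (z, ys z)) \<le> ereal d) \<longrightarrow> ereal (u (x, y)) \<le> ereal d"
    by (rule KN_cluster_point[OF KN F lim feas bdd])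
  have "value_function \<Phi> u x \<le> ereal (u (x, y))" using y by (rule value_function_le)
  also have "\<dots> \<le> ereal c" using bdd d by simp
  finally show False using less by simp
qed

lemma set_usc_at_solution_set:
  fixes \<Phi> :: "'a::topological_space \<Rightarrow> 'b::topological_space set" and u :: "'a \<times> 'b \<Rightarrow> real"
  assumes ne: "\<Phi> x \<noteq> {}" and KN: "KN_inf_compact \<Phi> (\<lambda>p. ereal (u p))"
    and lsc: "set_lsc_at \<Phi> x" and usc: "usc_on (Gr \<Phi>) (\<lambda>p. ereal (u p))"
  shows "set_usc_at (solution_set \<Phi> u) x"
  unfolding set_usc_at_def
proof (intro allI impI, rule ccontr)
  fix G assume G: "solution_set \<Phi> u x \<subseteq> interior G"
    and not: "\<not> (\<forall>\<^sub>F z in nhds x. solution_set \<Phi> u z \<subseteq> G)"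
  define B where "B = {z. \<not> solution_set \<Phi> u z \<subseteq> G}"
  define F where "F = inf (nhds x) (principal B)"
  have F: "F \<noteq> bot"
    using not by (auto simp: F_def B_def trivial_limit_def eventually_inf_principal)
  have lim: "((\<lambda>z. z) \<longlongrightarrow> x) F" unfolding F_def filterlim_def by simp
  have "\<forall>z\<in>B. \<exists>y. y \<in> solution_set \<Phi> u z \<and> y \<notin> G" by (auto simp: B_def)
  then obtain ys where "\<And>z. z \<in> B \<Longrightarrow> ys z \<in> solution_set \<Phi> u z \<and> ys z \<notin> G" by metis
  then have sol: "\<forall>\<^sub>F z in F. ys z \<in> solution_set \<Phi> u z \<and> ys z \<notin> G"
    by (simp add: F_def eventually_inf_principal)
  have feas: "\<forall>\<^sub>F z in F. ys z \<in> \<Phi> z" using sol by eventually_elim (simp add: solution_set_def)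
  have bdd: "\<forall>\<^sub>F z in F. u (z, ys z) < d" if "value_function \<Phi> u x < ereal d" for d
  proof -
    have "\<forall>\<^sub>F z in F. value_function \<Phi> u z < ereal d"
      using value_function_less_eventually[OF lsc usc that]
      unfolding F_def by (rule filter_leD[OF inf_le1])
    with sol show ?thesis by eventually_elim (auto simp: solution_set_def)
  qed
  obtain y where y: "y \<in> solution_set \<Phi> u x" "\<forall>U. open U \<and> y \<in> U \<longrightarrow> (\<exists>\<^sub>F z in F. ys z \<in> U)"
    by (rule solution_cluster_point[OF ne KN F lim feas bdd])
  have "\<exists>\<^sub>F z in F. ys z \<in> interior G" using y G by blast
  moreover have "\<forall>\<^sub>F z in F. ys z \<notin> interior G"
    using sol by eventually_elim (use interior_subset in blast)
  ultimately show False by (simp add: frequently_def)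
qed

theorem theorem1p4:
  fixes \<Phi> :: "'a::t2_space \<Rightarrow> 'b::t2_space set"
    and u :: "'a \<times> 'b \<Rightarrow> real"
  assumes "\<And>x. \<Phi> x \<noteq> {}"
    and "set_lsc \<Phi>"
    and "KN_inf_compact \<Phi> (\<lambda>p. ereal (u p))"
    and "usc_on (Gr \<Phi>) (\<lambda>p. ereal (u p))"
  shows "(\<forall>x. \<bar>value_function \<Phi> u x\<bar> \<noteq> \<infinity>) \<and>
         continuous_on UNIV (\<lambda>x. real_of_ereal (value_function \<Phi> u x)) \<and>
         (\<forall>x. solution_set \<Phi> u x \<noteq> {} \<and> compact (solution_set \<Phi> u x)) \<and>
         set_usc (solution_set \<Phi> u)"
proof -
  let ?v = "value_function \<Phi> u"
  have lsc: "set_lsc_at \<Phi> x" for x using assms(2) by (simp add: set_lsc_def)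
  have ne: "solution_set \<Phi> u x \<noteq> {}" for x by (rule solution_set_nonempty[OF assms(1,3)])
  have fin: "\<bar>?v x\<bar> \<noteq> \<infinity>" for x using ne[of x] by (auto simp: solution_set_def)
  have less: "?v x < ereal c \<longleftrightarrow> real_of_ereal (?v x) < c"
    and greater: "ereal c < ?v x \<longleftrightarrow> c < real_of_ereal (?v x)" for x c
    using fin[of x] by (cases "?v x"; simp)+
  have "((\<lambda>z. real_of_ereal (?v z)) \<longlongrightarrow> real_of_ereal (?v x)) (nhds x)" for x
    using value_function_greater_eventually[OF assms(1,3), of _ x]
      value_function_less_eventually[OF lsc assms(4), of x]
    unfolding less greater by (rule order_tendstoI)
  then have "isCont (\<lambda>x. real_of_ereal (?v x)) x" for x
    unfolding isCont_def by (rule tendsto_at_iff_tendsto_nhds[THEN iffD2])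
  then have "continuous_on UNIV (\<lambda>x. real_of_ereal (?v x))"
    by (simp add: continuous_at_imp_continuous_on)
  moreover have "set_usc (solution_set \<Phi> u)"
    unfolding set_usc_def using set_usc_at_solution_set[OF assms(1,3) lsc assms(4)] by blast
  moreover have "compact (solution_set \<Phi> u x)" for x
    by (rule compact_solution_set[OF assms(1,3)])
  ultimately show ?thesis using fin ne by simp
qed

end
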